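(* Let $(L,[\cdot,\cdot],\varphi_L,\alpha)$ be a (multiplicative) Hom-LieDer pair and let $(V;\rho_\beta,\varphi_V)$ be a representation of it, with respect to $\beta\in \mathfrak{gl}(V)$. Define on $L\oplus V$, for all $x,y\in L$ and $X,Y\in V$, $$[x+X,y+Y]_{L\oplus V}=[x,y]+\rho_\beta(x)(Y)-\rho_\beta(y)(X),$$ $$(\alpha+\beta)(x+X)=\alpha(x)+\beta(X),\qquad (\varphi_L+\varphi_V)(x+X)=\varphi_L(x)+\varphi_V(X).$$ Then $(L\oplus V,[\cdot,\cdot]_{L\oplus V},\varphi_L+\varphi_V,\alpha+\beta)$ is a (multiplicative) Hom-LieDer pair.
   Context: All vector spaces are over a field $\mathbb{K}$ of characteristic $0$. A multiplicative Hom-Lie algebra $(L,[\cdot,\cdot],\alpha)$ is a vector space $L$ with a skew-symmetric bilinear bracket and a linear map $\alpha:L\to L$ such that $\alpha([x,y])=[\alpha(x),\alpha(y)]$ and $[\alpha(x),[y,z]]+[\alpha(y),[z,x]]+[\alpha(z),[x,y]]=0$ for all $x,y,z\in L$. An $\alpha$-derivation is a linear map $\varphi_L:L\to L$ with $\varphi_L([x,y])=[\varphi_L(x),\alpha(y)]+[\alpha(x),\varphi_L(y)]$. A (multiplicative) Hom-LieDer pair $(L,[\cdot,\cdot],\varphi_L,\alpha)$ is a multiplicative Hom-Lie algebra together with an $\alpha$-derivation $\varphi_L$ (for $L\oplus V$: an $(\alpha+\beta)$-derivation). A representation of a multiplicative Hom-Lie algebra $(L,[\cdot,\cdot],\alpha)$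 on a vector space $V$ with respect to $\beta\in\mathfrak{gl}(V)$ is a linear map $\rho_\beta:L\to\mathfrak{gl}(V)$ such that $\rho_\beta(\alpha(x))\circ\beta=\beta\circ\rho_\beta(x)$ and $\rho_\beta([x,y])\circ\beta=\rho_\beta(\alpha(x))\circ\rho_\beta(y)-\rho_\beta(\alpha(y))\circ\rho_\beta(x)$ for all $x,y\in L$. A representation $(V;\rho_\beta,\varphi_V)$ of the Hom-LieDer pair is such a $\rho_\beta$ together with a linear map $\varphi_V:V\to V$ satisfying, for all $x\in L$, $$\varphi_V\circ\rho_\beta(x)-\rho_\beta(\alpha(x))\circ\varphi_V=\rho_\beta(\varphi_L(x))\circ\beta.$$ Here $\mathfrak{gl}(V)$ denotes the space of linear endomorphisms of $V$. *)

theory Defs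
  imports "HOL-Analysis.Product_Vector"
begin

(* A vector space is a type of class ab_group_add together with a scalar multiplication
   over a field of characteristic 0. *)

locale hom_lie_algebra = vector_space scl
  for scl :: "'k::field_char_0 \<Rightarrow> 'l::ab_group_add \<Rightarrow> 'l" +
  fixes bracket :: "'l \<Rightarrow> 'l \<Rightarrow> 'l"
    and \<alpha> :: "'l \<Rightarrow> 'l"
  assumes linear_bracket_right: "\<And>x. Vector_Spaces.linear scl scl (\<lambda>y. bracket x y)"
    and linear_bracket_left: "\<And>y. Vector_Spaces.linear scl scl (\<lambda>x. bracket x y)"
    and skew_symmetric: "\<And>x y. bracket x y = - bracket y x"
    and linear_alpha: "Vector_Spaces.linear scl scl \<alpha>"
    and multiplicative: "\<And>x y. \<alpha> (bracket x y) = bracket (\<alpha> x) (\<alpha> y)"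
    and hom_jacobi: "\<And>x y z. bracket (\<alpha> x) (bracket y z) + bracket (\<alpha> y) (bracket z x)
                       + bracket (\<alpha> z) (bracket x y) = 0"

definition alpha_derivation ::
  "('k::field_char_0 \<Rightarrow> 'l::ab_group_add \<Rightarrow> 'l) \<Rightarrow> ('l \<Rightarrow> 'l \<Rightarrow> 'l) \<Rightarrow> ('l \<Rightarrow> 'l) \<Rightarrow> ('l \<Rightarrow> 'l) \<Rightarrow> bool"
  where "alpha_derivation scl bracket \<alpha> \<phi> \<longleftrightarrow>
    Vector_Spaces.linear scl scl \<phi> \<and>
    (\<forall>x y. \<phi> (bracket x y) = bracket (\<phi> x) (\<alpha> y) + bracket (\<alpha> x) (\<phi> y))"

locale hom_lieder_pair = hom_lie_algebra scl bracket \<alpha>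
  for scl :: "'k::field_char_0 \<Rightarrow> 'l::ab_group_add \<Rightarrow> 'l"
    and bracket :: "'l \<Rightarrow> 'l \<Rightarrow> 'l"
    and \<phi> :: "'l \<Rightarrow> 'l"
    and \<alpha> :: "'l \<Rightarrow> 'l" +
  assumes derivation: "alpha_derivation scl bracket \<alpha> \<phi>"

(* The first two assumptions on \<rho> say that it is a linear map into gl(V): every \<rho> x is an
   endomorphism, and \<rho> is linear for the pointwise operations on endomorphisms. *)

locale hom_lie_representation =
  L: hom_lie_algebra scaleL bracket \<alpha> + V: vector_space scaleV
  for scaleL :: "'k::field_char_0 \<Rightarrow> 'l::ab_group_add \<Rightarrow> 'l"
    and bracket :: "'l \<Rightarrow> 'l \<Rightarrow> 'l"
    and \<alpha> :: "'l \<Rightarrow> 'l"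
    and scaleV :: "'k \<Rightarrow> 'v::ab_group_add \<Rightarrow> 'v" +
  fixes \<beta> :: "'v \<Rightarrow> 'v"
    and \<rho> :: "'l \<Rightarrow> 'v \<Rightarrow> 'v"
  assumes rho_endomorphism: "\<And>x. Vector_Spaces.linear scaleV scaleV (\<rho> x)"
    and linear_rho: "\<And>X. Vector_Spaces.linear scaleL scaleV (\<lambda>x. \<rho> x X)"
    and linear_beta: "Vector_Spaces.linear scaleV scaleV \<beta>"
    and rho_alpha: "\<And>x. \<rho> (\<alpha> x) \<circ> \<beta> = \<beta> \<circ> \<rho> x"
    and rho_bracket: "\<And>x y X. (\<rho> (bracket x y) \<circ> \<beta>) X
                        = (\<rho> (\<alpha> x) \<circ> \<rho> y) X - (\<rho> (\<alpha> y) \<circ> \<rho> x) X"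

locale hom_lieder_representation =
  L: hom_lieder_pair scaleL bracket \<phi>L \<alpha> +
  hom_lie_representation scaleL bracket \<alpha> scaleV \<beta> \<rho>
  for scaleL :: "'k::field_char_0 \<Rightarrow> 'l::ab_group_add \<Rightarrow> 'l"
    and bracket :: "'l \<Rightarrow> 'l \<Rightarrow> 'l"
    and \<phi>L :: "'l \<Rightarrow> 'l"
    and \<alpha> :: "'l \<Rightarrow> 'l"
    and scaleV :: "'k \<Rightarrow> 'v::ab_group_add \<Rightarrow> 'v"
    and \<beta> :: "'v \<Rightarrow> 'v"
    and \<rho> :: "'l \<Rightarrow> 'v \<Rightarrow> 'v" +
  fixes \<phi>V :: "'v \<Rightarrow> 'v"
  assumes linear_phiV: "Vector_Spaces.linear scaleV scaleV \<phi>V"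
    and phiV_rho: "\<And>x X. (\<phi>V \<circ> \<rho> x) X - (\<rho> (\<alpha> x) \<circ> \<phi>V) X = (\<rho> (\<phi>L x) \<circ> \<beta>) X"

(* The element x + X of the direct sum of L and V is the pair (x, X); scalar multiplication on the
   direct sum is module_prod.scale and the direct sum of two maps is map_prod. *)

definition semidirect_bracket ::
  "('l \<Rightarrow> 'l \<Rightarrow> 'l) \<Rightarrow> ('l \<Rightarrow> 'v::ab_group_add \<Rightarrow> 'v) \<Rightarrow> 'l \<times> 'v \<Rightarrow> 'l \<times> 'v \<Rightarrow> 'l \<times> 'v"
  where "semidirect_bracket bracket \<rho> =
    (\<lambda>(x, X) (y, Y). (bracket x y, \<rho> x Y - \<rho> y X))"

end

theory Submission
  imports Defs
begin

text \<open>
  Every identity required of the direct sum splits into a component in $L$ and a component in $V$.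
  The $L$-component is the same identity for $L$ itself. Bilinearity and skew symmetry in the
  $V$-component are immediate from the shape of \<open>\<rho> x Y - \<rho> y X\<close>. In the other identities each
  summand of the $V$-component involves exactly one of the given vectors of $V$, because the bracket
  of two elements of $V$ vanishes, so the summands can be collected vector by vector. What must hold
  for one vector is one instance of an axiom for \<open>\<rho>\<close>: compatibility with \<open>\<alpha>\<close> and \<open>\<beta>\<close> gives
  multiplicativity, compatibility with the bracket gives the Hom-Jacobi identity, and compatibility
  with the derivations gives the derivation rule.
\<close>

lemma linear_map_prod:
  assumes f: "Vector_Spaces.linear s1 s1 f" and g: "Vector_Spaces.linear s2 s2 g"
  shows "Vector_Spaces.linear (module_prod.scale s1 s2) (module_prod.scale s1 s2) (map_prod f g)"
proof -
  interpret f: Vector_Spaces.linear s1 s1 f by (fact f)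
  interpret g: Vector_Spaces.linear s2 s2 g by (fact g)
  interpret P: vector_space_prod s1 s2 ..
  show ?thesis
    unfolding Vector_Spaces.linear_iff
    by (auto simp: P.scale_prod f.add g.add f.scale g.scale P.p.vector_space_axioms)
qed

context hom_lie_representation
begin

interpretation vector_space_prod scaleL scaleV ..

lemma linear_semidirect_bracket_right:
  "Vector_Spaces.linear scale scale (semidirect_bracket bracket \<rho> u)"
proof -
  obtain x X where u: "u = (x, X)" by (cases u)
  interpret b: Vector_Spaces.linear scaleL scaleL "bracket x" by (rule L.linear_bracket_right)
  interpret r: Vector_Spaces.linear scaleV scaleV "\<rho> x" by (rule rho_endomorphism)
  interpret s: Vector_Spaces.linear scaleL scaleV "\<lambda>y. \<rho> y X" by (rule linear_rho)
  show ?thesis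
    unfolding Vector_Spaces.linear_iff
    by (auto simp: u semidirect_bracket_def scale_prod b.add b.scale r.add r.scale s.add s.scale
        V.scale_right_diff_distrib p.vector_space_axioms)
qed

lemma semidirect_bracket_skew_symmetric:
  "semidirect_bracket bracket \<rho> u w = - semidirect_bracket bracket \<rho> w u"
  by (auto simp: semidirect_bracket_def intro: L.skew_symmetric split: prod.split)

text \<open>By skew symmetry, linearity in one argument gives linearity in the other.\<close>

lemma linear_semidirect_bracket_left:
  "Vector_Spaces.linear scale scale (\<lambda>u. semidirect_bracket bracket \<rho> u w)"
proof -
  interpret b: Vector_Spaces.linear scale scale "semidirect_bracket bracket \<rho> w"
    by (rule linear_semidirect_bracket_right)
  show ?thesis
    unfolding Vector_Spaces.linear_iff semidirect_bracket_skew_symmetric[of _ w]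
    by (auto simp: b.add b.scale p.vector_space_axioms)
qed

lemma semidirect_bracket_multiplicative:
  "map_prod \<alpha> \<beta> (semidirect_bracket bracket \<rho> u w)
    = semidirect_bracket bracket \<rho> (map_prod \<alpha> \<beta> u) (map_prod \<alpha> \<beta> w)"
proof -
  interpret b: Vector_Spaces.linear scaleV scaleV \<beta> by (rule linear_beta)
  have "\<rho> (\<alpha> x) (\<beta> X) = \<beta> (\<rho> x X)" for x X
    using fun_cong[OF rho_alpha] by simp
  then show ?thesis
    by (auto simp: semidirect_bracket_def L.multiplicative b.diff split: prod.split)
qed

text \<open>
  The vector \<open>Z\<close> occurs in the three cyclic terms as \<open>\<rho> (\<alpha> x) (\<rho> y Z)\<close>, \<open>- \<rho> (\<alpha> y) (\<rho> x Z)\<close> and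
  \<open>- \<rho> (bracket x y) (\<beta> Z)\<close>, whose sum vanishes by compatibility with the bracket; \<open>X\<close> and \<open>Y\<close> behave
  the same way by cyclic symmetry.
\<close>

lemma semidirect_bracket_hom_jacobi:
  "semidirect_bracket bracket \<rho> (map_prod \<alpha> \<beta> u) (semidirect_bracket bracket \<rho> v w)
    + semidirect_bracket bracket \<rho> (map_prod \<alpha> \<beta> v) (semidirect_bracket bracket \<rho> w u)
    + semidirect_bracket bracket \<rho> (map_prod \<alpha> \<beta> w) (semidirect_bracket bracket \<rho> u v) = 0"
proof -
  obtain x X y Y z Z where uvw: "u = (x, X)" "v = (y, Y)" "w = (z, Z)"
    by (cases u, cases v, cases w)
  have diff: "\<rho> a (B - C) = \<rho> a B - \<rho> a C" for a B C
  proof -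
    interpret r: Vector_Spaces.linear scaleV scaleV "\<rho> a" by (rule rho_endomorphism)
    show ?thesis by (rule r.diff)
  qed
  have bracket: "\<rho> (bracket a b) (\<beta> C) = \<rho> (\<alpha> a) (\<rho> b C) - \<rho> (\<alpha> b) (\<rho> a C)" for a b C
    using rho_bracket by simp
  show ?thesis
    by (simp add: uvw semidirect_bracket_def L.hom_jacobi diff bracket zero_prod_def)
qed

lemma semidirect_product_hom_lie_algebra:
  "hom_lie_algebra scale (semidirect_bracket bracket \<rho>) (map_prod \<alpha> \<beta>)"
  by (intro hom_lie_algebra.intro hom_lie_algebra_axioms.intro p.vector_space_axioms
      linear_semidirect_bracket_right linear_semidirect_bracket_left
      semidirect_bracket_skew_symmetric linear_map_prod[OF L.linear_alpha linear_beta]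
      semidirect_bracket_multiplicative semidirect_bracket_hom_jacobi)

end

context hom_lieder_representation
begin

text \<open>
  Solved for \<open>\<phi>V (\<rho> x Y)\<close>, the compatibility of \<open>\<rho>\<close> with the derivations is already the derivation
  rule for the bracket of an element of $L$ with an element of $V$. The general case is its
  antisymmetrization together with the derivation rule in $L$.
\<close>

lemma semidirect_product_alpha_derivation:
  "alpha_derivation (module_prod.scale scaleL scaleV) (semidirect_bracket bracket \<rho>)
    (map_prod \<alpha> \<beta>) (map_prod \<phi>L \<phi>V)"
proof -
  interpret f: Vector_Spaces.linear scaleV scaleV \<phi>V by (rule linear_phiV)
  have phiL: "Vector_Spaces.linear scaleL scaleL \<phi>L"
      "\<phi>L (bracket x y) = bracket (\<phi>L x) (\<alpha> y) + bracket (\<alpha> x) (\<phi>L y)" for x y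
    using L.derivation by (simp_all add: alpha_derivation_def)
  have "\<phi>V (\<rho> x X) = \<rho> (\<phi>L x) (\<beta> X) + \<rho> (\<alpha> x) (\<phi>V X)" for x X
    using phiV_rho[of x X] by (simp add: algebra_simps)
  then show ?thesis
    unfolding alpha_derivation_def
    by (auto simp: linear_map_prod phiL linear_phiV semidirect_bracket_def f.diff)
qed

end

theorem proposition3p5:
  fixes scaleL :: "'k::field_char_0 \<Rightarrow> 'l::ab_group_add \<Rightarrow> 'l"
    and scaleV :: "'k \<Rightarrow> 'v::ab_group_add \<Rightarrow> 'v"
    and bracket :: "'l \<Rightarrow> 'l \<Rightarrow> 'l"
    and \<phi>L \<alpha> :: "'l \<Rightarrow> 'l"
    and \<beta> \<phi>V :: "'v \<Rightarrow> 'v"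
    and \<rho> :: "'l \<Rightarrow> 'v \<Rightarrow> 'v"
  assumes "hom_lieder_pair scaleL bracket \<phi>L \<alpha>"
    and "hom_lieder_representation scaleL bracket \<phi>L \<alpha> scaleV \<beta> \<rho> \<phi>V"
  shows "hom_lieder_pair (module_prod.scale scaleL scaleV) (semidirect_bracket bracket \<rho>)
           (map_prod \<phi>L \<phi>V) (map_prod \<alpha> \<beta>)"
proof -
  interpret R: hom_lieder_representation scaleL bracket \<phi>L \<alpha> scaleV \<beta> \<rho> \<phi>V
    by (fact assms(2))
  show ?thesis
    by (intro hom_lieder_pair.intro hom_lieder_pair_axioms.intro
        R.semidirect_product_hom_lie_algebra R.semidirect_product_alpha_derivation)
qed

end
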